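(* Let $k\le 4$, let $(x_i,y_i)\in\mathbb{P}^1\times\mathbb{P}^1$ for $i=1,\dots,k$, and let $Z_k$ be the $k\times 4$ matrix with rows $x_i^\top\otimes y_i^\top$, $i=1,\dots,k$. Then: (1) $\operatorname{rank}(Z_2)<2$ if and only if $x_1=x_2$ and $y_1=y_2$. (2) $\operatorname{rank}(Z_3)<3$ if and only if either an inherited condition holds, or $x_1=x_2=x_3$, or $y_1=y_2=y_3$. (3) $\operatorname{rank}(Z_4)<4$ if and only if the following bracket equation holds: $$[13]_x[24]_x[14]_y[23]_y=[14]_x[23]_x[13]_y[24]_y.$$ Generically $x_1,\dots,x_4$ are distinct and $y_1,\dots,y_4$ are distinct, and in that case the bracket equation holds if and only if there is a homography $H\in\mathrm{PGL}(2)$ such that $Hx_i=y_i$ in $\mathbb{P}^1$ for $i=1,\dots,4$.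
   Context: $\mathbb{P}^n$ is projective space over $\mathbb{C}$; points are represented by nonzero column vectors (the rank of $Z_k$ and the vanishing of the bracket expressions do not depend on the choice of representatives). $\otimes$ is the Kronecker product. An inherited condition holds for $Z_k$ if the rows of $Z_k$ indexed by some proper subset of $\{1,\dots,k\}$ are linearly dependent. For points $p_1,\dots,p_k\in\mathbb{P}^1$ with representatives $p_i=(p_{i1},p_{i2})$, $[ij]=\det\begin{bmatrix} p_{i1} & p_{i2} \\ p_{j1} & p_{j2} \end{bmatrix}$; $[ij]_x$ and $[ij]_y$ denote these brackets for the points $x_i$ and $y_i$ respectively. *)

theory Defs
  imports "HOL-Analysis.Analysis"
begin

definition proj_rel :: "complex^'n \<Rightarrow> complex^'n \<Rightarrow> bool" where
  "proj_rel v w \<longleftrightarrow> v \<noteq> 0 \<and> w \<noteq> 0 \<and> (\<exists>c. c \<noteq> 0 \<and> v = c *s w)"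

lemma part_equivp_proj_rel: "part_equivp (proj_rel :: complex^'n \<Rightarrow> _)"
proof (rule part_equivpI)
  have "proj_rel (vec 1) (vec 1 :: complex^'n)"
    unfolding proj_rel_def
    by (metis one_neq_zero scalar_mult_eq_scaleR scaleR_one vec_component vector_smult_lid zero_index)
  then show "\<exists>x :: complex^'n. proj_rel x x" by blast
  show "symp (proj_rel :: complex^'n \<Rightarrow> _)"
  proof (rule sympI)
    fix v w :: "complex^'n"
    assume "proj_rel v w"
    then obtain c where "v \<noteq> 0" "w \<noteq> 0" "c \<noteq> 0" "v = c *s w"
      unfolding proj_rel_def by blast
    then show "proj_rel w v"
      unfolding proj_rel_def
      by (intro conjI exI[of _ "inverse c"]) auto
  qed
  show "transp (proj_rel :: complex^'n \<Rightarrow> _)"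
    unfolding proj_rel_def transp_def
    by (metis mult_eq_0_iff vector_smult_assoc)
qed

text \<open>Complex projective space of dimension \<open>CARD('n) - 1\<close>; in particular \<open>2 proj\<close> is
  the projective line.\<close>

quotient_type (overloaded) 'n proj = "complex^'n::finite" / partial: proj_rel
  by (rule part_equivp_proj_rel)

definition represents :: "complex^'n \<Rightarrow> 'n proj \<Rightarrow> bool" where
  "represents v p \<longleftrightarrow> v \<noteq> 0 \<and> abs_proj v = p"

definition pgl_rel :: "complex^'n^'n \<Rightarrow> complex^'n^'n \<Rightarrow> bool" where
  "pgl_rel A B \<longleftrightarrow> invertible A \<and> invertible B \<and> (\<exists>c. c \<noteq> 0 \<and> A = (\<chi> i j. c * B $ i $ j))"

lemma part_equivp_pgl_rel: "part_equivp (pgl_rel :: complex^'n^'n \<Rightarrow> _)"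
proof (rule part_equivpI)
  have "pgl_rel (mat 1) (mat 1 :: complex^'n^'n)"
    unfolding pgl_rel_def by (auto intro!: exI[of _ 1] exI[of _ "mat 1"] simp: invertible_def vec_eq_iff)
  then show "\<exists>x :: complex^'n^'n. pgl_rel x x" by blast
  show "symp (pgl_rel :: complex^'n^'n \<Rightarrow> _)"
  proof (rule sympI)
    fix A B :: "complex^'n^'n"
    assume "pgl_rel A B"
    then obtain c where "invertible A" "invertible B" "c \<noteq> 0" "A = (\<chi> i j. c * B $ i $ j)"
      unfolding pgl_rel_def by blast
    moreover from this have "B = (\<chi> i j. inverse c * A $ i $ j)"
      by (simp add: vec_eq_iff)
    ultimately show "pgl_rel B A"
      unfolding pgl_rel_def by (metis inverse_nonzero_iff_nonzero)
  qed
  show "transp (pgl_rel :: complex^'n^'n \<Rightarrow> _)"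
  proof (rule transpI)
    fix A B C :: "complex^'n^'n"
    assume "pgl_rel A B" "pgl_rel B C"
    then obtain c d where "invertible A" "invertible C" "c \<noteq> 0" "A = (\<chi> i j. c * B $ i $ j)"
      "d \<noteq> 0" "B = (\<chi> i j. d * C $ i $ j)"
      unfolding pgl_rel_def by blast
    moreover from this have "A = (\<chi> i j. (c * d) * C $ i $ j)"
      by (simp add: vec_eq_iff)
    ultimately show "pgl_rel A C"
      unfolding pgl_rel_def by (metis mult_eq_0_iff)
  qed
qed

text \<open>\<open>'n pgl\<close> is the projective linear group PGL(n) over the complex numbers, n = \<open>CARD('n)\<close>.\<close>

quotient_type (overloaded) 'n pgl = "complex^'n^'n::finite" / partial: pgl_rel
  by (rule part_equivp_pgl_rel)

lift_definition homography :: "'n pgl \<Rightarrow> 'n::finite proj \<Rightarrow> 'n proj" is "\<lambda>A v. A *v v"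
proof -
  fix A B :: "complex^'n^'n" and v w :: "complex^'n"
  assume "pgl_rel A B" "proj_rel v w"
  then obtain c d where *: "invertible A" "invertible B" "c \<noteq> 0" "A = (\<chi> i j. c * B $ i $ j)"
      "v \<noteq> 0" "w \<noteq> 0" "d \<noteq> 0" "v = d *s w"
    unfolding pgl_rel_def proj_rel_def by blast
  have nz: "M *v u \<noteq> 0" if "invertible M" "u \<noteq> 0" for M :: "complex^'n^'n" and u
    using that by (metis invertible_left_inverse matrix_left_invertible_ker)
  have "A *v v = (c * d) *s (B *v w)"
    by (simp add: * matrix_vector_mult_def vec_eq_iff sum_distrib_left algebra_simps)
  with * nz show "proj_rel (A *v v) (B *v w)"
    unfolding proj_rel_def by (metis mult_eq_0_iff)
qed

text \<open>Kronecker product of two vectors of length 2, in the usual (lexicographic) order.\<close>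

definition kron :: "complex^2 \<Rightarrow> complex^2 \<Rightarrow> complex^4" where
  "kron u v = vector [u $ 1 * v $ 1, u $ 1 * v $ 2, u $ 2 * v $ 1, u $ 2 * v $ 2]"

text \<open>The number \<open>k\<close> of points is \<open>CARD('k)\<close>; the points are indexed by the numeral types
  \<open>2\<close>, \<open>3\<close>, \<open>4\<close>, whose elements are \<open>1, \<dots>, k\<close> (with \<open>k = 0\<close> in the type \<open>k\<close>).\<close>

definition Zmat :: "('k \<Rightarrow> complex^2) \<Rightarrow> ('k \<Rightarrow> complex^2) \<Rightarrow> complex^4^'k" where
  "Zmat u v = (\<chi> i. kron (u i) (v i))"

text \<open>Linear dependence is that of the rows as an indexed family, so that two equal rows
  are dependent.\<close>

definition rows_dependent :: "complex^'n^'k \<Rightarrow> 'k set \<Rightarrow> bool" where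
  "rows_dependent Z S \<longleftrightarrow>
     (\<exists>c. (\<exists>i\<in>S. c i \<noteq> 0) \<and> (\<Sum>i\<in>S. c i *s row i Z) = 0)"

definition inherited_condition :: "complex^'n^'k \<Rightarrow> bool" where
  "inherited_condition Z \<longleftrightarrow> (\<exists>S. S \<subset> UNIV \<and> rows_dependent Z S)"

definition bracket :: "('k \<Rightarrow> complex^2) \<Rightarrow> 'k \<Rightarrow> 'k \<Rightarrow> complex" where
  "bracket u i j = det (vector [u i, u j] :: complex^2^2)"

text \<open>Genericity is meant in the Zariski topology of a product of projective spaces, whose closed
  sets are the common zero sets of multihomogeneous polynomials in the coordinates of
  the factors.  Polynomials are represented by the functions they induce, which is harmless
  over the complex numbers.\<close>

inductive poly_fun ::
  "(('i \<Rightarrow> complex^'m) \<Rightarrow> ('i \<Rightarrow> complex^'n) \<Rightarrow> complex) \<Rightarrow> bool" where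
  const: "poly_fun (\<lambda>u v. c)"
| coord1: "poly_fun (\<lambda>u v. u i $ a)"
| coord2: "poly_fun (\<lambda>u v. v i $ b)"
| add: "poly_fun F \<Longrightarrow> poly_fun G \<Longrightarrow> poly_fun (\<lambda>u v. F u v + G u v)"
| mult: "poly_fun F \<Longrightarrow> poly_fun G \<Longrightarrow> poly_fun (\<lambda>u v. F u v * G u v)"

definition multihomogeneous ::
  "(('i::finite \<Rightarrow> complex^'m) \<Rightarrow> ('i \<Rightarrow> complex^'n) \<Rightarrow> complex) \<Rightarrow> bool" where
  "multihomogeneous F \<longleftrightarrow> poly_fun F \<and>
     (\<exists>d e :: 'i \<Rightarrow> nat. \<forall>a b u v.
        F (\<lambda>i. a i *s u i) (\<lambda>i. b i *s v i) = (\<Prod>i\<in>UNIV. a i ^ d i * b i ^ e i) * F u v)"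

definition zariski_closed ::
  "(('i::finite \<Rightarrow> 'm::finite proj) \<times> ('i \<Rightarrow> 'n::finite proj)) set \<Rightarrow> bool" where
  "zariski_closed C \<longleftrightarrow> (\<exists>\<F>. (\<forall>F\<in>\<F>. multihomogeneous F) \<and>
     C = {(x, y). \<forall>F\<in>\<F>. \<forall>u v.
            (\<forall>i. represents (u i) (x i)) \<and> (\<forall>i. represents (v i) (y i)) \<longrightarrow> F u v = 0})"

text \<open>A product of projective spaces is irreducible, so a nonempty Zariski-open set is dense.\<close>

definition generically ::
  "(('i::finite \<Rightarrow> 'm::finite proj) \<Rightarrow> ('i \<Rightarrow> 'n::finite proj) \<Rightarrow> bool) \<Rightarrow> bool" where
  "generically P \<longleftrightarrow> (\<exists>C. zariski_closed C \<and> C \<noteq> UNIV \<and> (\<forall>x y. (x, y) \<notin> C \<longrightarrow> P x y))"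

end

theory Submission
  imports Defs
begin

text \<open>
  Row \<open>i\<close> of \<open>Zmat u v\<close> is the decomposable tensor \<open>u i \<otimes> v i\<close>, and the rank drops exactly when
  these tensors satisfy a nontrivial linear relation (\<open>rank_less_iff_rows_dependent\<close>). So each
  rank condition is a question about linear relations between decomposable tensors. The bracket
  \<open>[ij]\<close> detects equality of points on the projective line (\<open>bracket_eq_0_iff\<close>), and pairing a
  relation \<open>\<Sum>i. c i (u i \<otimes> v i) = 0\<close> in its first factor with the linear form \<open>[u j, -]\<close> kills the
  term \<open>j\<close> and leaves a relation between the remaining \<open>v i\<close> in the plane.

  For two rows this gives that dependence means equality of both points
  (\<open>rows_dependent_pair_iff\<close>). For three rows, a relation with a zero coefficient is an inherited
  one. If all coefficients are nonzero and two of the \<open>x i\<close> differ, pairing with those two leaves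
  two-term relations that force all \<open>y i\<close> to coincide (\<open>all_eq_if_dependent_triple\<close>). Conversely, if
  all \<open>x i\<close> coincide, then the three tensors lie in a two-dimensional space
  (\<open>rows_dependent_triple_if_eq\<close>). For four rows, \<open>Zmat u v\<close> is square and its determinant is the
  difference of the two sides of the bracket equation (\<open>det_Zmat\<close>).

  Distinctness of all points is the nonvanishing of the product of all brackets, a
  multihomogeneous polynomial which is not zero at suitable points (\<open>generically_distinct\<close>).

  For distinct points, the bracket equation says that \<open>x\<close> and \<open>y\<close> have the same cross-ratio. An
  invertible matrix multiplies all brackets by its determinant, and the representatives of each
  point occur equally often on both sides, so a homography implies the equation
  (\<open>bracket_equation_if_matrix\<close>). Conversely, there is an explicit matrix that takes \<open>u 1, u 2, u 3\<close>
  to multiples of \<open>v 1, v 2, v 3\<close>, and the bracket equation is the condition that it takes \<open>u 4\<close> to a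
  multiple of \<open>v 4\<close> (\<open>matrix_if_bracket_equation\<close>).
\<close>

section \<open>Rank and linear dependence of the rows\<close>

lemma rows_dependent_mono:
  assumes "rows_dependent Z S" "S \<subseteq> T" "finite T"
  shows "rows_dependent Z T"
proof -
  obtain c where c: "\<exists>i\<in>S. c i \<noteq> 0" "(\<Sum>i\<in>S. c i *s row i Z) = 0"
    using assms(1) unfolding rows_dependent_def by blast
  have "(\<Sum>i\<in>T. (if i \<in> S then c i else 0) *s row i Z) = (\<Sum>i\<in>S. c i *s row i Z)"
    using assms(2,3) by (intro sum.mono_neutral_cong_right) auto
  with c assms(2) show ?thesis
    unfolding rows_dependent_def by (intro exI[of _ "\<lambda>i. if i \<in> S then c i else 0"]) auto
qed

text \<open>The rank is the dimension of the span of the \<^emph>\<open>set\<close> of rows, whereas dependence here concerns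
  the indexed family. The two agree because a repeated row makes the family dependent and also
  makes the set of rows smaller than the index type.\<close>

lemma rank_less_iff_rows_dependent:
  fixes Z :: "complex^'n^'k"
  shows "rank Z < CARD('k) \<longleftrightarrow> rows_dependent Z UNIV"
proof -
  let ?r = "\<lambda>i. row i Z"
  have rows: "rows Z = range ?r" by (auto simp: rows_def)
  have card: "card (rows Z) \<le> CARD('k)" unfolding rows by (simp add: card_image_le)
  have fin: "finite (rows Z)" by (simp add: rows)
  show ?thesis
  proof
    assume less: "rank Z < CARD('k)"
    show "rows_dependent Z UNIV"
    proof (cases "inj ?r")
      case True
      then have "card (rows Z) = CARD('k)" by (simp add: rows card_image)
      with less have "vec.dependent (rows Z)"
        using vec.dim_eq_card_independent[of "rows Z"] by (auto simp: row_rank_def_gen)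
      then obtain c where "\<exists>w\<in>rows Z. c w \<noteq> 0" "(\<Sum>w\<in>rows Z. c w *s w) = 0"
        using vec.dependent_finite[OF fin] by blast
      with True show ?thesis
        unfolding rows_dependent_def rows
        by (intro exI[of _ "\<lambda>i. c (row i Z)"]) (auto simp: sum.reindex)
    next
      case False
      then obtain i j where ij: "i \<noteq> j" "row i Z = row j Z" by (auto simp: inj_on_def)
      have "rows_dependent Z {i, j}"
        unfolding rows_dependent_def using ij
        by (intro exI[of _ "\<lambda>l. if l = i then 1 else -1"]) auto
      then show ?thesis by (rule rows_dependent_mono) auto
    qed
  next
    assume "rows_dependent Z UNIV"
    then obtain c i where c: "c i \<noteq> 0" "(\<Sum>i\<in>UNIV. c i *s row i Z) = 0"
      unfolding rows_dependent_def by blast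
    show "rank Z < CARD('k)"
    proof (rule ccontr)
      assume "\<not> rank Z < CARD('k)"
      then have ge: "CARD('k) \<le> vec.dim (rows Z)" by (simp add: row_rank_def_gen)
      have ind: "vec.independent (rows Z)"
        by (rule vec.card_le_dim_spanning[of _ "rows Z"])
           (use fin card ge in \<open>auto intro: vec.span_base\<close>)
      then have "card (rows Z) = CARD('k)"
        using card ge vec.dim_eq_card_independent by fastforce
      then have inj: "inj ?r" unfolding rows by (simp add: eq_card_imp_inj_on)
      have inv: "inv ?r (row l Z) = l" for l using inv_f_f[OF inj] .
      have "(\<Sum>w\<in>rows Z. c (inv ?r w) *s w) = 0"
        unfolding rows using c(2) inj by (simp add: sum.reindex inv)
      moreover have "c (inv ?r (row i Z)) \<noteq> 0" using c(1) by (simp add: inv)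
      moreover have "row i Z \<in> rows Z" by (simp add: rows)
      ultimately have "vec.dependent (rows Z)"
        unfolding vec.dependent_finite[OF fin]
        by (intro exI[of _ "\<lambda>w. c (inv ?r w)"] conjI bexI[of _ "row i Z"])
      with ind show False by simp
    qed
  qed
qed

lemma rows_dependent_iff_det:
  fixes Z :: "complex^'n^'n"
  shows "rows_dependent Z UNIV \<longleftrightarrow> det Z = 0"
proof -
  have "det Z \<noteq> 0 \<longleftrightarrow> (\<exists>B. Z ** B = mat 1)"
    by (simp add: invertible_det_nz[symmetric] invertible_right_inverse)
  then show ?thesis
    unfolding rows_dependent_def matrix_right_invertible_independent_rows by blast
qed

section \<open>Coordinates and brackets\<close>

lemma vec2_eq_iff: "(a :: 'a^2) = b \<longleftrightarrow> a $ 1 = b $ 1 \<and> a $ 2 = b $ 2"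
  by (simp add: vec_eq_iff forall_2)

lemma bracket_expand: "bracket u i j = u i $ 1 * u j $ 2 - u i $ 2 * u j $ 1"
  by (simp add: bracket_def det_2)

lemma row_Zmat: "row i (Zmat u v) = kron (u i) (v i)"
  by (simp add: row_def Zmat_def vec_eq_iff)

lemma kron_nth:
  "kron a b $ 1 = a $ 1 * b $ 1" "kron a b $ 2 = a $ 1 * b $ 2"
  "kron a b $ 3 = a $ 2 * b $ 1" "kron a b $ 4 = a $ 2 * b $ 2"
proof -
  have "\<forall>i::4. vector [p, q, r, s :: complex] $ i =
      (if i = 1 then p else if i = 2 then q else if i = 3 then r else s)" for p q r s
    unfolding forall_4 by (simp add: vector_def)
  then show
    "kron a b $ 1 = a $ 1 * b $ 1" "kron a b $ 2 = a $ 1 * b $ 2"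
    "kron a b $ 3 = a $ 2 * b $ 1" "kron a b $ 4 = a $ 2 * b $ 2"
    unfolding kron_def by simp_all
qed

lemma rows_dependent_Zmat_iff:
  "rows_dependent (Zmat u v) S \<longleftrightarrow>
     (\<exists>c. (\<exists>i\<in>S. c i \<noteq> 0) \<and> (\<forall>a b. (\<Sum>i\<in>S. c i * (u i $ a * v i $ b)) = 0))"
  unfolding rows_dependent_def row_Zmat
  by (simp add: vec_eq_iff forall_4 forall_2 kron_nth)

lemma proportional_iff:
  fixes a b :: "complex^2"
  assumes "a \<noteq> 0" "b \<noteq> 0"
  shows "a $ 1 * b $ 2 = a $ 2 * b $ 1 \<longleftrightarrow> (\<exists>c. c \<noteq> 0 \<and> a = c *s b)"
proof
  assume eq: "a $ 1 * b $ 2 = a $ 2 * b $ 1"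
  show "\<exists>c. c \<noteq> 0 \<and> a = c *s b"
  proof (cases "b $ 1 = 0")
    case True
    then have "b $ 2 \<noteq> 0" using assms by (simp add: vec2_eq_iff)
    with eq True assms show ?thesis
      by (intro exI[of _ "a $ 2 / b $ 2"]) (auto simp: vec2_eq_iff)
  next
    case False
    with eq assms show ?thesis
      by (intro exI[of _ "a $ 1 / b $ 1"]) (auto simp: vec2_eq_iff field_simps)
  qed
qed auto

lemma represents_eq_iff:
  assumes "represents a p" "represents b q"
  shows "p = q \<longleftrightarrow> (\<exists>c. c \<noteq> 0 \<and> a = c *s b)"
proof -
  have refl: "proj_rel w w" if "w \<noteq> 0" for w :: "complex^'a"
    using that unfolding proj_rel_def by (metis one_neq_zero vector_smult_lid)
  have "abs_proj a = abs_proj b \<longleftrightarrow> proj_rel a b"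
    using Quotient3_rel[OF Quotient3_proj, of a b] refl assms by (auto simp: represents_def)
  with assms show ?thesis by (auto simp: represents_def proj_rel_def)
qed

lemma bracket_eq_0_iff:
  assumes "\<forall>i. represents (u i) (x i)"
  shows "bracket u i j = 0 \<longleftrightarrow> x i = x j"
  using assms represents_eq_iff[of "u i" "x i" "u j" "x j"] proportional_iff[of "u i" "u j"]
  by (auto simp: bracket_expand represents_def)

section \<open>Two and three rows\<close>

text \<open>In a relation between two nonzero decomposable tensors both coefficients are nonzero. Then
  fixing a nonzero coordinate of the second factors shows that the first factors are parallel,
  and symmetrically.\<close>

lemma rows_dependent_pair_iff:
  assumes x: "\<forall>i. represents (u i) (x i)" and y: "\<forall>i. represents (v i) (y i)"
    and "i \<noteq> j"
  shows "rows_dependent (Zmat u v) {i, j} \<longleftrightarrow> x i = x j \<and> y i = y j"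
proof
  assume "x i = x j \<and> y i = y j"
  then obtain c d where cd: "c \<noteq> 0" "u i = c *s u j" "d \<noteq> 0" "v i = d *s v j"
    using x y represents_eq_iff by metis
  then show "rows_dependent (Zmat u v) {i, j}"
    unfolding rows_dependent_Zmat_iff using \<open>i \<noteq> j\<close>
    by (intro exI[of _ "\<lambda>l. if l = i then 1 else - (c * d)"]) auto
next
  assume "rows_dependent (Zmat u v) {i, j}"
  then obtain c where nz: "c i \<noteq> 0 \<or> c j \<noteq> 0"
    and eq: "c i * (u i $ a * v i $ b) + c j * (u j $ a * v j $ b) = 0" for a b
    unfolding rows_dependent_Zmat_iff using \<open>i \<noteq> j\<close> by auto
  have coord: "\<exists>a. w $ a \<noteq> 0" if "represents w p" for w :: "complex^2" and p
    using that by (auto simp: represents_def vec_eq_iff)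
  obtain a b a' b' where ab: "u i $ a \<noteq> 0" "v i $ b \<noteq> 0" "u j $ a' \<noteq> 0" "v j $ b' \<noteq> 0"
    using coord x y by metis
  \<comment> \<open>A coordinate where one tensor does not vanish rules out that the other coefficient is zero.\<close>
  have ci: "c i \<noteq> 0"
    using eq[of a' b'] nz ab by auto
  have cj: "c j \<noteq> 0"
    using eq[of a b] nz ab by auto
  have "c i * v i $ b * bracket u i j * (c j * v j $ b') = 0"
  proof -
    have "c i * v i $ b * bracket u i j * (c j * v j $ b') =
      (c i * (u i $ 1 * v i $ b)) * (c j * (u j $ 2 * v j $ b'))
      - (c i * (u i $ 2 * v i $ b)) * (c j * (u j $ 1 * v j $ b'))"
      by (simp add: bracket_expand algebra_simps)
    also have "\<dots> = 0"
      using eq[of 1 b] eq[of 2 b] eq[of 1 b'] eq[of 2 b']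
      by (simp add: add_eq_0_iff2 algebra_simps)
    finally show ?thesis .
  qed
  moreover have "c i * u i $ a * bracket v i j * (c j * u j $ a') = 0"
  proof -
    have "c i * u i $ a * bracket v i j * (c j * u j $ a') =
      (c i * (u i $ a * v i $ 1)) * (c j * (u j $ a' * v j $ 2))
      - (c i * (u i $ a * v i $ 2)) * (c j * (u j $ a' * v j $ 1))"
      by (simp add: bracket_expand algebra_simps)
    also have "\<dots> = 0"
      using eq[of a 1] eq[of a 2] eq[of a' 1] eq[of a' 2]
      by (simp add: add_eq_0_iff2 algebra_simps)
    finally show ?thesis .
  qed
  ultimately show "x i = x j \<and> y i = y j"
    using ab ci cj x y bracket_eq_0_iff by (metis mult_eq_0_iff)
qed

lemma Zmat_swap_rows_dependent:
  fixes u v :: "'k::finite \<Rightarrow> complex^2"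
  shows "rows_dependent (Zmat u v) S \<longleftrightarrow> rows_dependent (Zmat v u) S"
proof -
  have "(\<forall>a b. (\<Sum>i\<in>S. c i * (u i $ a * v i $ b)) = 0) \<longleftrightarrow>
        (\<forall>a b. (\<Sum>i\<in>S. c i * (v i $ a * u i $ b)) = 0)" for c
    by (subst all_comm) (simp add: mult_ac)
  then show ?thesis unfolding rows_dependent_Zmat_iff by simp
qed

text \<open>When \<open>x i = x j = x k\<close> the three tensors are \<open>u k \<otimes> w\<close> with \<open>w\<close> a multiple of \<open>v i\<close>,
  \<open>v j\<close>, \<open>v k\<close> respectively, and these plane vectors satisfy \<open>[jk] v i - [ik] v j + [ij] v k = 0\<close>. This relation is trivial if all brackets
  vanish, hence the separate treatment of \<open>y i = y j\<close>, in which two rows are already dependent.\<close>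

lemma rows_dependent_triple_if_eq:
  assumes x: "\<forall>i. represents (u i) (x i)" and y: "\<forall>i. represents (v i) (y i)"
    and d: "i \<noteq> j" "j \<noteq> k" "i \<noteq> k" and eq: "x i = x j" "x j = x k"
  shows "rows_dependent (Zmat u v) {i, j, k}"
proof (cases "y i = y j")
  case True
  with eq d have "rows_dependent (Zmat u v) {i, j}"
    using rows_dependent_pair_iff[OF x y] by simp
  then show ?thesis by (rule rows_dependent_mono) auto
next
  case False
  then have nz: "bracket v i j \<noteq> 0" using bracket_eq_0_iff[OF y] by simp
  obtain p q where pq: "p \<noteq> 0" "u i = p *s u k" "q \<noteq> 0" "u j = q *s u k"
    using x eq represents_eq_iff by metis
  have "\<forall>b. bracket v j k * v i $ b - bracket v i k * v j $ b + bracket v i j * v k $ b = 0"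
    unfolding forall_2 by (simp add: bracket_expand algebra_simps)
  then have plucker: "u k $ a * (bracket v j k * v i $ b - bracket v i k * v j $ b
      + bracket v i j * v k $ b) = 0" for a b
    by simp
  have "bracket v j k / p * (u i $ a * v i $ b) + (- bracket v i k / q * (u j $ a * v j $ b)
      + bracket v i j * (u k $ a * v k $ b)) = 0" for a b
    using plucker[of a b] pq by (simp add: algebra_simps)
  with d nz show ?thesis
    unfolding rows_dependent_Zmat_iff
    by (intro exI[of _ "\<lambda>l. if l = i then bracket v j k / p else if l = j then - bracket v i k / q
                             else bracket v i j"])
       auto
qed

text \<open>Pairing the relation with \<open>[u i, -]\<close> in the first factor leaves a two-term relation between
  \<open>v j\<close> and \<open>v k\<close>, and pairing with \<open>[u j, -]\<close> leaves one between \<open>v i\<close> and \<open>v k\<close>. Their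
  coefficients at \<open>v j\<close> and \<open>v i\<close> are nonzero because \<open>[ij]\<close>, \<open>c i\<close> and \<open>c j\<close> are, so the vectors are parallel.\<close>

lemma all_eq_if_dependent_triple:
  fixes u v :: "'k \<Rightarrow> complex^2"
  assumes x: "\<forall>i. represents (u i) (x i)" and y: "\<forall>i. represents (v i) (y i)"
    and c: "c i \<noteq> 0" "c j \<noteq> 0" "c k \<noteq> 0"
    and eq: "\<And>a b. c i * (u i $ a * v i $ b) + c j * (u j $ a * v j $ b)
                   + c k * (u k $ a * v k $ b) = 0"
    and ne: "x i \<noteq> x j"
  shows "y i = y j \<and> y j = y k"
proof -
  have nz: "bracket u i j \<noteq> 0" using ne bracket_eq_0_iff[OF x] by simp
  have *: "c j * bracket u i j * v j $ b + c k * bracket u i k * v k $ b = 0" for b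
    using arg_cong2[OF arg_cong[OF eq[of 2 b], of "\<lambda>z. u i $ 1 * z"]
        arg_cong[OF eq[of 1 b], of "\<lambda>z. u i $ 2 * z"], of "(-)"]
    by (simp add: bracket_expand algebra_simps)
  have **: "c i * bracket u i j * v i $ b = c k * bracket u j k * v k $ b" for b
    using arg_cong2[OF arg_cong[OF eq[of 2 b], of "\<lambda>z. u j $ 1 * z"]
        arg_cong[OF eq[of 1 b], of "\<lambda>z. u j $ 2 * z"], of "(-)"]
    by (simp add: bracket_expand algebra_simps)
  have "(c j * bracket u i j) * bracket v j k =
      (c j * bracket u i j * v j $ 1) * v k $ 2 - (c j * bracket u i j * v j $ 2) * v k $ 1"
    by (simp add: bracket_expand algebra_simps)
  also have "\<dots> = 0"
    using *[of 1] *[of 2] by (simp add: add_eq_0_iff2)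
  finally have jk: "y j = y k" using c nz bracket_eq_0_iff[OF y] by simp
  have "(c i * bracket u i j) * bracket v i k =
      (c i * bracket u i j * v i $ 1) * v k $ 2 - (c i * bracket u i j * v i $ 2) * v k $ 1"
    by (simp add: bracket_expand algebra_simps)
  also have "\<dots> = 0"
    unfolding ** by simp
  finally have "y i = y k" using c nz bracket_eq_0_iff[OF y] by simp
  with jk show ?thesis by simp
qed

lemma rank_Zmat_3:
  fixes x y :: "3 \<Rightarrow> 2 proj"
  assumes x: "\<forall>i. represents (u i) (x i)" and y: "\<forall>i. represents (v i) (y i)"
  shows "rank (Zmat u v) < 3 \<longleftrightarrow>
    inherited_condition (Zmat u v) \<or> (x 1 = x 2 \<and> x 2 = x 3) \<or> (y 1 = y 2 \<and> y 2 = y 3)"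
proof -
  have rank: "rank (Zmat u v) < 3 \<longleftrightarrow> rows_dependent (Zmat u v) UNIV"
    using rank_less_iff_rows_dependent[of "Zmat u v"] by simp
  have d: "(1::3) \<noteq> 2" "(2::3) \<noteq> 3" "(1::3) \<noteq> 3" by simp_all
  show ?thesis
    unfolding rank
  proof
    assume dep: "rows_dependent (Zmat u v) UNIV"
    then obtain c where nz: "\<exists>i. c i \<noteq> 0"
      and eq: "\<And>a b. (\<Sum>i\<in>UNIV. c i * (u i $ a * v i $ b)) = 0"
      unfolding rows_dependent_Zmat_iff by auto
    show "inherited_condition (Zmat u v) \<or> (x 1 = x 2 \<and> x 2 = x 3) \<or> (y 1 = y 2 \<and> y 2 = y 3)"
    proof (cases "\<exists>k. c k = 0")
      case True
      then obtain k where k: "c k = 0" ..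
      have "rows_dependent (Zmat u v) (- {k})"
        unfolding rows_dependent_Zmat_iff
      proof (intro exI[of _ c] conjI allI)
        show "\<exists>i\<in>-{k}. c i \<noteq> 0" using nz k by auto
        fix a b
        have "(\<Sum>i\<in>-{k}. c i * (u i $ a * v i $ b)) = (\<Sum>i\<in>UNIV. c i * (u i $ a * v i $ b))"
          using k by (intro sum.mono_neutral_left) auto
        then show "(\<Sum>i\<in>-{k}. c i * (u i $ a * v i $ b)) = 0" using eq by simp
      qed
      then show ?thesis unfolding inherited_condition_def by blast
    next
      case False
      then have c: "c i \<noteq> 0" for i by auto
      note sum = eq[unfolded sum_3]
      consider "x 1 \<noteq> x 2" | "x 2 \<noteq> x 3" | "x 1 = x 2 \<and> x 2 = x 3" by blast
      then show ?thesis
      proof cases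
        case 1
        then show ?thesis
          using all_eq_if_dependent_triple[OF x y, of c 1 2 3, OF c c c] sum by simp
      next
        case 2
        then show ?thesis
          using all_eq_if_dependent_triple[OF x y, of c 2 3 1, OF c c c] sum by (simp add: ac_simps)
      qed auto
    qed
  next
    assume "inherited_condition (Zmat u v) \<or> (x 1 = x 2 \<and> x 2 = x 3) \<or> (y 1 = y 2 \<and> y 2 = y 3)"
    then consider "inherited_condition (Zmat u v)" | "x 1 = x 2" "x 2 = x 3" | "y 1 = y 2" "y 2 = y 3"
      by blast
    then show "rows_dependent (Zmat u v) UNIV"
    proof cases
      case 1
      then show ?thesis
        unfolding inherited_condition_def by (auto intro: rows_dependent_mono)
    next
      case 2
      then show ?thesis
        using rows_dependent_triple_if_eq[OF x y d] by (simp add: UNIV_3)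
    next
      case 3
      then show ?thesis
        using rows_dependent_triple_if_eq[OF y x d] Zmat_swap_rows_dependent by (metis UNIV_3)
    qed
  qed
qed

section \<open>Four rows\<close>

lemma det_4:
  fixes A :: "'a::comm_ring_1^4^4"
  shows "det A =
    A$1$1 * (A$2$2 * (A$3$3 * A$4$4 - A$3$4 * A$4$3) - A$2$3 * (A$3$2 * A$4$4 - A$3$4 * A$4$2)
           + A$2$4 * (A$3$2 * A$4$3 - A$3$3 * A$4$2))
  - A$1$2 * (A$2$1 * (A$3$3 * A$4$4 - A$3$4 * A$4$3) - A$2$3 * (A$3$1 * A$4$4 - A$3$4 * A$4$1)
           + A$2$4 * (A$3$1 * A$4$3 - A$3$3 * A$4$1))
  + A$1$3 * (A$2$1 * (A$3$2 * A$4$4 - A$3$4 * A$4$2) - A$2$2 * (A$3$1 * A$4$4 - A$3$4 * A$4$1)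
           + A$2$4 * (A$3$1 * A$4$2 - A$3$2 * A$4$1))
  - A$1$4 * (A$2$1 * (A$3$2 * A$4$3 - A$3$3 * A$4$2) - A$2$2 * (A$3$1 * A$4$3 - A$3$3 * A$4$1)
           + A$2$3 * (A$3$1 * A$4$2 - A$3$2 * A$4$1))"
proof -
  have f1: "finite {2::4, 3, 4}" "1 \<notin> {2::4, 3, 4}" by auto
  have f2: "finite {3::4, 4}" "2 \<notin> {3::4, 4}" by auto
  have f3: "finite {4::4}" "3 \<notin> {4::4}" by auto
  show ?thesis
    unfolding det_def UNIV_4
    unfolding sum_over_permutations_insert[OF f1]
    unfolding sum_over_permutations_insert[OF f2]
    unfolding sum_over_permutations_insert[OF f3]
    unfolding permutes_sing
    by (simp add: sign_swap_id permutation_swap_id sign_compose sign_id permutation_compose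
        transpose_def)
       (simp only: ring_distribs ac_simps diff_conv_add_uminus
         minus_mult_left[symmetric] minus_mult_right[symmetric] minus_add_distrib minus_minus)
qed

text \<open>The determinant is linear in every representative and invariant under a change of basis of
  determinant one in either factor, so it must be a combination of products of brackets in which
  each point occurs once per factor; the two products below are the ones needed.\<close>

lemma det_Zmat:
  fixes u v :: "4 \<Rightarrow> complex^2"
  shows "det (Zmat u v) =
    bracket u 1 4 * bracket u 2 3 * bracket v 1 3 * bracket v 2 4
    - bracket u 1 3 * bracket u 2 4 * bracket v 1 4 * bracket v 2 3"
  unfolding det_4 bracket_expand Zmat_def vec_lambda_beta kron_nth
  \<comment> \<open>With differences turned into sums of negated monomials, ordered rewriting sorts both sides
    into the same monomials up to cancellation, which the second call performs.\<close>
  by (simp only: ring_distribs ac_simps diff_conv_add_uminus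
      minus_mult_left[symmetric] minus_mult_right[symmetric] minus_add_distrib minus_minus) simp

section \<open>Distinctness is generic\<close>

lemma poly_fun_prod:
  assumes "\<And>i. i \<in> S \<Longrightarrow> poly_fun (F i)"
  shows "poly_fun (\<lambda>u v. \<Prod>i\<in>S. F i u v)"
  using assms by (induction S rule: infinite_finite_induct) (auto intro: poly_fun.intros)

lemma poly_fun_diff:
  assumes "poly_fun F" "poly_fun G"
  shows "poly_fun (\<lambda>u v. F u v - G u v)"
  using poly_fun.add[OF assms(1) poly_fun.mult[OF poly_fun.const[of "-1"] assms(2)]] by simp

lemma poly_fun_bracket:
  "poly_fun (\<lambda>u v. bracket u i j)" "poly_fun (\<lambda>u v. bracket v i j)"
  unfolding bracket_expand by (rule poly_fun_diff; intro poly_fun.intros)+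

text \<open>Each unordered pair of indices contributes twice, which only squares the polynomial up to sign
  and spares the choice of an order on the index type.\<close>

definition distinctness_poly :: "('i::finite \<Rightarrow> complex^2) \<Rightarrow> ('i \<Rightarrow> complex^2) \<Rightarrow> complex" where
  "distinctness_poly u v = (\<Prod>i\<in>UNIV. \<Prod>j\<in>-{i}. bracket u i j * bracket v i j)"

lemma distinctness_poly_nonzero_iff:
  assumes "\<forall>i. represents (u i) (x i)" "\<forall>i. represents (v i) (y i)"
  shows "distinctness_poly u v \<noteq> 0 \<longleftrightarrow> inj x \<and> inj y"
  using bracket_eq_0_iff[OF assms(1)] bracket_eq_0_iff[OF assms(2)]
  by (auto simp: distinctness_poly_def inj_on_def)

text \<open>Each index occurs \<open>CARD('i) - 1\<close> times as the first and as often as the second member of an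
  ordered pair of distinct indices. This gives the multidegree of \<open>distinctness_poly\<close>.\<close>

lemma prod_pairs:
  fixes a :: "'i::finite \<Rightarrow> 'a::comm_monoid_mult"
  shows "(\<Prod>i\<in>UNIV. \<Prod>j\<in>-{i}. a i * a j) = (\<Prod>i\<in>UNIV. a i ^ (2 * (CARD('i) - 1)))"
proof -
  have "(\<Prod>i\<in>UNIV. \<Prod>j\<in>-{i}. a j) = (\<Prod>j\<in>UNIV. \<Prod>i\<in>-{j}. a j)"
    using prod.swap_restrict[of UNIV UNIV "\<lambda>i j. a j" "\<lambda>i j. i \<noteq> j"]
    by (simp add: Compl_eq_Diff_UNIV set_diff_eq eq_commute)
  moreover have "card (- {i}) = CARD('i) - 1" for i :: 'i
    by (simp add: Compl_eq_Diff_UNIV card_Diff_singleton)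
  ultimately show ?thesis
    unfolding prod.distrib prod_constant mult_2 power_add by simp
qed

lemma multihomogeneous_distinctness_poly:
  "multihomogeneous (distinctness_poly :: ('i::finite \<Rightarrow> complex^2) \<Rightarrow> _)"
  unfolding multihomogeneous_def
proof (intro conjI exI allI)
  show "poly_fun (distinctness_poly :: ('i \<Rightarrow> complex^2) \<Rightarrow> _)"
    unfolding distinctness_poly_def[abs_def]
    by (intro poly_fun_prod poly_fun.mult poly_fun_bracket)
next
  fix a b :: "'i \<Rightarrow> complex" and u v :: "'i \<Rightarrow> complex^2"
  let ?n = "2 * (CARD('i) - 1)"
  have scale: "bracket (\<lambda>i. c i *s w i) i j = c i * c j * bracket w i j"
    for c and w :: "'i \<Rightarrow> complex^2" and i j
    by (simp add: bracket_expand algebra_simps)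
  have "distinctness_poly (\<lambda>i. a i *s u i) (\<lambda>i. b i *s v i)
      = (\<Prod>i\<in>UNIV. \<Prod>j\<in>-{i}. (a i * a j) * ((b i * b j) * (bracket u i j * bracket v i j)))"
    unfolding distinctness_poly_def scale by (simp add: ac_simps)
  also have "\<dots> = (\<Prod>i\<in>UNIV. a i ^ ?n) * ((\<Prod>i\<in>UNIV. b i ^ ?n) * distinctness_poly u v)"
    unfolding distinctness_poly_def prod_pairs[symmetric] prod.distrib ..
  finally show "distinctness_poly (\<lambda>i. a i *s u i) (\<lambda>i. b i *s v i)
      = (\<Prod>i\<in>UNIV. a i ^ ?n * b i ^ ?n) * distinctness_poly u v"
    by (simp add: prod.distrib ac_simps)
qed

text \<open>The zero set of \<open>distinctness_poly\<close> is a proper subset because the projective line is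
  infinite: the points \<open>(1 : n)\<close> for natural numbers \<open>n\<close> are pairwise distinct.\<close>

lemma generically_distinct:
  "generically (\<lambda>(x :: 'i::finite \<Rightarrow> 2 proj) (y :: 'i \<Rightarrow> 2 proj). inj x \<and> inj y)"
proof -
  define C :: "(('i \<Rightarrow> 2 proj) \<times> ('i \<Rightarrow> 2 proj)) set" where
    "C = {(x, y). \<forall>F\<in>{distinctness_poly}. \<forall>u v.
            (\<forall>i. represents (u i) (x i)) \<and> (\<forall>i. represents (v i) (y i)) \<longrightarrow> F u v = 0}"
  have "zariski_closed C"
    unfolding zariski_closed_def C_def
    by (intro exI[of _ "{distinctness_poly}"]) (simp add: multihomogeneous_distinctness_poly)
  moreover have "C \<noteq> UNIV"
  proof -
    define w :: "'i \<Rightarrow> complex^2" where "w i = vector [1, of_nat (to_nat i)]" for i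
    define x where "x i = abs_proj (w i)" for i
    have rep: "\<forall>i. represents (w i) (x i)"
      by (auto simp: represents_def x_def w_def vec2_eq_iff)
    have "inj x"
    proof (rule injI)
      fix i j assume "x i = x j"
      then have "bracket w i j = 0" using bracket_eq_0_iff[OF rep] by simp
      then show "i = j" by (simp add: bracket_expand w_def)
    qed
    then have "(x, x) \<notin> C"
      using rep distinctness_poly_nonzero_iff[OF rep rep] unfolding C_def by blast
    then show ?thesis by blast
  qed
  moreover have "inj x \<and> inj y" if "(x, y) \<notin> C" for x y
    using that distinctness_poly_nonzero_iff unfolding C_def by blast
  ultimately show ?thesis unfolding generically_def by blast
qed

section \<open>Homographies and the bracket equation\<close>

lemma represents_homography:
  assumes "invertible A" "represents w p"
  shows "represents (A *v w) (homography (abs_pgl A) p)"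
proof -
  have "pgl_rel A A" using assms(1) unfolding pgl_rel_def by (auto intro!: exI[of _ 1] simp: vec_eq_iff)
  moreover have "proj_rel w w"
    using assms(2) unfolding proj_rel_def represents_def by (metis one_neq_zero vector_smult_lid)
  moreover have "A *v w \<noteq> 0"
    using assms unfolding represents_def by (metis invertible_left_inverse matrix_left_invertible_ker)
  ultimately show ?thesis
    using assms(2) homography.abs_eq unfolding represents_def by metis
qed

lemma homography_exists_iff:
  assumes "\<forall>i. represents (u i) (x i)" "\<forall>i. represents (v i) (y i)"
  shows "(\<exists>H. \<forall>i. homography H (x i) = y i) \<longleftrightarrow>
    (\<exists>A. invertible A \<and> (\<forall>i. \<exists>c. c \<noteq> 0 \<and> A *v u i = c *s v i))"
proof -
  have "(\<exists>H. P H) \<longleftrightarrow> (\<exists>A. invertible A \<and> P (abs_pgl A))" for P :: "'b pgl \<Rightarrow> bool"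
    using pgl.abs_induct[of "\<lambda>H. \<exists>A. invertible A \<and> H = abs_pgl A"] unfolding pgl_rel_def by metis
  moreover have "homography (abs_pgl A) (x i) = y i \<longleftrightarrow> (\<exists>c. c \<noteq> 0 \<and> A *v u i = c *s v i)"
    if "invertible A" for A i
    using represents_eq_iff represents_homography[OF that] assms by blast
  ultimately show ?thesis by auto
qed

lemma matrix_vector_mult_2:
  fixes A :: "complex^2^2"
  shows "(A *v w) $ i = A $ i $ 1 * w $ 1 + A $ i $ 2 * w $ 2"
  by (simp add: matrix_vector_mult_def sum_2)

lemma bracket_matrix: "bracket (\<lambda>i. A *v u i) i j = det A * bracket u i j"
  by (simp add: bracket_expand matrix_vector_mult_2 det_2 algebra_simps)

text \<open>If \<open>A u i = c i v i\<close>, then \<open>det A [ij]\<^sub>x = c i c j [ij]\<^sub>y\<close>. Both \<open>[13]\<^sub>x [24]\<^sub>x\<close> and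
  \<open>[14]\<^sub>x [23]\<^sub>x\<close> use every index once, so they are the corresponding products for \<open>y\<close> times the same
  factor \<open>c 1 c 2 c 3 c 4 / (det A)\<^sup>2\<close>.\<close>

lemma bracket_equation_if_matrix:
  assumes "invertible A" "\<forall>i. A *v u i = c i *s v i"
  shows "bracket u 1 3 * bracket u 2 4 * bracket v 1 4 * bracket v 2 3 =
         bracket u 1 4 * bracket u 2 3 * bracket v 1 3 * bracket v 2 4"
proof -
  have d: "det A \<noteq> 0" using assms(1) invertible_det_nz by blast
  have b: "det A * bracket u i j = c i * c j * bracket v i j" for i j
    using bracket_matrix[of A u i j] assms(2) by (simp add: bracket_expand algebra_simps)
  have "(det A * bracket u 1 3) * (det A * bracket u 2 4) * (bracket v 1 4 * bracket v 2 3) =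
        (det A * bracket u 1 4) * (det A * bracket u 2 3) * (bracket v 1 3 * bracket v 2 4)"
    unfolding b by (simp add: ac_simps)
  with d show ?thesis by (simp add: algebra_simps)
qed

text \<open>The map \<open>w \<mapsto> \<alpha> [w, u 2] v 1 + \<beta> [u 1, w] v 2\<close> takes the points of \<open>u 1\<close> and \<open>u 2\<close> to those of
  \<open>v 1\<close> and \<open>v 2\<close> for all nonzero \<open>\<alpha>\<close> and \<open>\<beta>\<close>. By the identity
  \<open>[12] v 3 = [32] v 1 + [13] v 2\<close> the ratio of \<open>\<alpha>\<close> and \<open>\<beta>\<close> can be chosen so that the point of
  \<open>u 3\<close> goes to that of \<open>v 3\<close>; the values below are this choice with denominators cleared. The
  bracket of the image of \<open>u 4\<close> with \<open>v 4\<close> is then the difference of the two sides of the equation.\<close>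

lemma matrix_if_bracket_equation:
  fixes u v :: "4 \<Rightarrow> complex^2"
  assumes u: "\<And>i j. i \<noteq> j \<Longrightarrow> bracket u i j \<noteq> 0" and v: "\<And>i j. i \<noteq> j \<Longrightarrow> bracket v i j \<noteq> 0"
    and eq: "bracket u 1 3 * bracket u 2 4 * bracket v 1 4 * bracket v 2 3 =
             bracket u 1 4 * bracket u 2 3 * bracket v 1 3 * bracket v 2 4"
  shows "\<exists>A. invertible A \<and> (\<forall>i. \<exists>c. c \<noteq> 0 \<and> A *v u i = c *s v i)"
proof -
  define \<alpha> where "\<alpha> = bracket v 3 2 * bracket u 1 3"
  define \<beta> where "\<beta> = bracket v 1 3 * bracket u 3 2"
  define A :: "complex^2^2" where
    "A = (\<chi> i j. \<alpha> * v 1 $ i * (if j = 1 then u 2 $ 2 else - u 2 $ 1)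
               + \<beta> * v 2 $ i * (if j = 1 then - u 1 $ 2 else u 1 $ 1))"
  have nz: "\<alpha> \<noteq> 0" "\<beta> \<noteq> 0" using u v by (auto simp: \<alpha>_def \<beta>_def)
  have A: "A *v u i = (\<alpha> * bracket u i 2) *s v 1 + (\<beta> * bracket u 1 i) *s v 2" for i
    by (simp add: vec_eq_iff forall_2 matrix_vector_mult_2 A_def bracket_expand algebra_simps)
  have det: "det A = \<alpha> * \<beta> * bracket u 1 2 * bracket v 1 2"
    by (simp add: det_2 A_def bracket_expand algebra_simps)
  then have inv: "invertible A" using nz u v by (simp add: invertible_det_nz)
  have par: "(A *v u i) $ 1 * v i $ 2 = (A *v u i) $ 2 * v i $ 1" for i
  proof -
    have cross: "(A *v u i) $ 1 * v i $ 2 - (A *v u i) $ 2 * v i $ 1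
        = \<alpha> * bracket u i 2 * bracket v 1 i + \<beta> * bracket u 1 i * bracket v 2 i"
      unfolding A by (simp add: bracket_expand algebra_simps)
    have neg: "bracket w j i = - bracket w i j" for w :: "4 \<Rightarrow> complex^2" and i j
      by (simp add: bracket_expand)
    have refl: "bracket w i i = 0" for w :: "4 \<Rightarrow> complex^2" and i
      by (simp add: bracket_expand)
    have "\<forall>i. \<alpha> * bracket u i 2 * bracket v 1 i + \<beta> * bracket u 1 i * bracket v 2 i = 0"
      unfolding forall_4
      using eq neg[of u 2 3] neg[of v 2 3] neg[of u 2 4]
      by (simp add: refl \<alpha>_def \<beta>_def ac_simps)
    with cross show ?thesis by simp
  qed
  have "A *v u i \<noteq> 0" "v i \<noteq> 0" for i
  proof -
    obtain j where "i \<noteq> j" by (metis zero_neq_one)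
    with u v have nz: "u i \<noteq> 0" "v i \<noteq> 0" by (force simp: bracket_expand)+
    then show "v i \<noteq> 0" "A *v u i \<noteq> 0"
      using inv by (metis invertible_left_inverse matrix_left_invertible_ker)+
  qed
  with par inv proportional_iff show ?thesis by blast
qed

theorem theorem4p1:
  shows
    "(\<forall>(x :: 2 \<Rightarrow> 2 proj) (y :: 2 \<Rightarrow> 2 proj) u v.
        (\<forall>i. represents (u i) (x i)) \<and> (\<forall>i. represents (v i) (y i)) \<longrightarrow>
        (rank (Zmat u v) < 2 \<longleftrightarrow> x 1 = x 2 \<and> y 1 = y 2)) \<and>
     (\<forall>(x :: 3 \<Rightarrow> 2 proj) (y :: 3 \<Rightarrow> 2 proj) u v.
        (\<forall>i. represents (u i) (x i)) \<and> (\<forall>i. represents (v i) (y i)) \<longrightarrow>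
        (rank (Zmat u v) < 3 \<longleftrightarrow>
           inherited_condition (Zmat u v) \<or> (x 1 = x 2 \<and> x 2 = x 3) \<or> (y 1 = y 2 \<and> y 2 = y 3))) \<and>
     (\<forall>(x :: 4 \<Rightarrow> 2 proj) (y :: 4 \<Rightarrow> 2 proj) u v.
        (\<forall>i. represents (u i) (x i)) \<and> (\<forall>i. represents (v i) (y i)) \<longrightarrow>
        (rank (Zmat u v) < 4 \<longleftrightarrow>
           bracket u 1 3 * bracket u 2 4 * bracket v 1 4 * bracket v 2 3 =
           bracket u 1 4 * bracket u 2 3 * bracket v 1 3 * bracket v 2 4)) \<and>
     generically (\<lambda>(x :: 4 \<Rightarrow> 2 proj) (y :: 4 \<Rightarrow> 2 proj). inj x \<and> inj y) \<and>
     (\<forall>(x :: 4 \<Rightarrow> 2 proj) (y :: 4 \<Rightarrow> 2 proj) u v.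
        (\<forall>i. represents (u i) (x i)) \<and> (\<forall>i. represents (v i) (y i)) \<and> inj x \<and> inj y \<longrightarrow>
        (bracket u 1 3 * bracket u 2 4 * bracket v 1 4 * bracket v 2 3 =
         bracket u 1 4 * bracket u 2 3 * bracket v 1 3 * bracket v 2 4 \<longleftrightarrow>
           (\<exists>H :: 2 pgl. \<forall>i. homography H (x i) = y i)))"
proof (intro conjI allI impI; (elim conjE)?)
  fix x y :: "2 \<Rightarrow> 2 proj" and u v
  assume xy: "\<forall>i. represents (u i) (x i)" "\<forall>i. represents (v i) (y i)"
  show "rank (Zmat u v) < 2 \<longleftrightarrow> x 1 = x 2 \<and> y 1 = y 2"
    using rank_less_iff_rows_dependent[of "Zmat u v"] rows_dependent_pair_iff[OF xy, of 1 2]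
    unfolding UNIV_2[symmetric] by simp
next
  fix x y :: "3 \<Rightarrow> 2 proj" and u v
  assume "\<forall>i. represents (u i) (x i)" "\<forall>i. represents (v i) (y i)"
  then show "rank (Zmat u v) < 3 \<longleftrightarrow>
      inherited_condition (Zmat u v) \<or> (x 1 = x 2 \<and> x 2 = x 3) \<or> (y 1 = y 2 \<and> y 2 = y 3)"
    by (rule rank_Zmat_3)
next
  fix u v :: "4 \<Rightarrow> complex^2"
  show "rank (Zmat u v) < 4 \<longleftrightarrow>
      bracket u 1 3 * bracket u 2 4 * bracket v 1 4 * bracket v 2 3 =
      bracket u 1 4 * bracket u 2 3 * bracket v 1 3 * bracket v 2 4"
    using rank_less_iff_rows_dependent[of "Zmat u v"] rows_dependent_iff_det[of "Zmat u v"]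
    by (auto simp: det_Zmat)
next
  show "generically (\<lambda>(x :: 4 \<Rightarrow> 2 proj) (y :: 4 \<Rightarrow> 2 proj). inj x \<and> inj y)"
    by (rule generically_distinct)
next
  fix x y :: "4 \<Rightarrow> 2 proj" and u v
  assume xy: "\<forall>i. represents (u i) (x i)" "\<forall>i. represents (v i) (y i)" and "inj x" "inj y"
  then have "bracket u i j \<noteq> 0" "bracket v i j \<noteq> 0" if "i \<noteq> j" for i j
    using that bracket_eq_0_iff[OF xy(1)] bracket_eq_0_iff[OF xy(2)] by (auto dest: injD)
  then show "bracket u 1 3 * bracket u 2 4 * bracket v 1 4 * bracket v 2 3 =
      bracket u 1 4 * bracket u 2 3 * bracket v 1 3 * bracket v 2 4 \<longleftrightarrow>
      (\<exists>H :: 2 pgl. \<forall>i. homography H (x i) = y i)"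
    unfolding homography_exists_iff[OF xy]
    using matrix_if_bracket_equation bracket_equation_if_matrix by metis
qed

end
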